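(* Let $N\ge1$, let $\Gamma_1,\dots,\Gamma_N$ be nonzero integers and $D_\Gamma=\operatorname{diag}(\Gamma_1,\dots,\Gamma_N)$. The function $$C:\mathfrak u(N)\to\mathbb R,\qquad C(\mu)=\operatorname{tr}(-\mathrm i D_\Gamma\mu)=\sum_{i=1}^N\Gamma_i\mu_i$$ is a Casimir of the Lie–Poisson bracket $\{\cdot,\cdot\}_\Gamma$, i.e. $\{C,f\}_\Gamma=0$ for every smooth $f:\mathfrak u(N)\to\mathbb R$. As a result, $C$ is an invariant (constant along solutions) of the Lie–Poisson equation $$\dot\mu=D_\Gamma^{-1}\frac{\delta h}{\delta\mu}\mu-\mu\frac{\delta h}{\delta\mu}D_\Gamma^{-1}.$$
   Context: $\mathfrak u(N)$ denotes the real vector space of $N\times N$ complex skew-Hermitian matrices, identified with its dual by the inner product $\langle\xi,\eta\rangle=\frac12\operatorname{tr}(\xi^*\eta)$, and equipped with the Lie bracket $[\xi,\eta]_\Gamma=\xi D_\Gamma^{-1}\eta-\eta D_\Gamma^{-1}\xi$. For smooth $f$ on (an open subset of) $\mathfrak u(N)$, $\frac{\delta f}{\delta\mu}\in\mathfrak u(N)$ is defined by $\langle\nu,\frac{\delta f}{\delta\mu}\rangle=\frac{d}{ds}\big|_{s=0}f(\mu+s\nu)$ for all $\nu$. The Lie–Poisson bracket is $$\{f,k\}_\Gamma(\mu)=\Bigl\langle\mu,\Bigl[\frac{\delta f}{\delta\mu},\frac{\delta k}{\delta\mu}\Bigr]_\Gamma\Bigr\rangle .$$ Write $\mu=\mathrm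 iM$ with $M$ Hermitian, with diagonal entries $\mu_i\in\mathbb R$ and above-diagonal entries $\mu_{ij}\in\mathbb C$ ($i<j$). For a constant $c>0$, $$h(\mu)=\frac12\Bigl(\sum_i\Gamma_i^2\ln(1-\mu_i)-c\sum_{i<j}\Gamma_i\Gamma_j\ln(\mu_i+\mu_j-2\operatorname{Re}\mu_{ij})\Bigr)$$ on the open set where $\mu_i<1$ for all $i$ and $\mu_i+\mu_j-2\operatorname{Re}\mu_{ij}>0$ for all $i<j$. *)

theory Defs
  imports "HOL-Analysis.Analysis"
begin

definition conj_transpose :: "complex^'n^'m \<Rightarrow> complex^'m^'n" where
  "conj_transpose A = map_matrix cnj (transpose A)"

definition skew_hermitian :: "(complex^'n^'n) set" where
  "skew_hermitian = {\<xi>. conj_transpose \<xi> = - \<xi>}"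

text \<open>The trace below is already real when both arguments are skew-Hermitian;
  the real part only fixes the type.\<close>

definition u_inner :: "complex^'n^'n \<Rightarrow> complex^'n^'n \<Rightarrow> real" where
  "u_inner \<xi> \<eta> = Re (trace (conj_transpose \<xi> ** \<eta>)) / 2"

definition diag_mat :: "('n::finite \<Rightarrow> int) \<Rightarrow> complex^'n^'n" where
  "diag_mat \<Gamma> = (\<chi> i j. if i = j then of_int (\<Gamma> i) else 0)"

definition u_bracket :: "('n::finite \<Rightarrow> int) \<Rightarrow> complex^'n^'n \<Rightarrow> complex^'n^'n \<Rightarrow> complex^'n^'n" where
  "u_bracket \<Gamma> \<xi> \<eta> =
     \<xi> ** matrix_inv (diag_mat \<Gamma>) ** \<eta> - \<eta> ** matrix_inv (diag_mat \<Gamma>) ** \<xi>"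

text \<open>Functions on the space of skew-Hermitian matrices are represented by functions on all
  complex matrices, of which only the values at skew-Hermitian matrices matter.
  Accordingly, for a real linear subspace V, the predicate \<open>Ck_on V k f\<close> says that the
  restriction of f to V is k times continuously differentiable as a function on V.
  The derivative within V is determined only in directions tangent to V,
  and only those are used.\<close>

primrec Ck_on :: "'a::real_normed_vector set \<Rightarrow> nat \<Rightarrow> ('a \<Rightarrow> real) \<Rightarrow> bool" where
  "Ck_on V 0 f \<longleftrightarrow> continuous_on V f"
| "Ck_on V (Suc k) f \<longleftrightarrow>
     (\<exists>f'. (\<forall>x\<in>V. (f has_derivative f' x) (at x within V)) \<and>
           (\<forall>v\<in>V. Ck_on V k (\<lambda>x. f' x v)))"

definition u_smooth :: "(complex^'n^'n \<Rightarrow> real) \<Rightarrow> bool" where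
  "u_smooth f \<longleftrightarrow> (\<forall>k. Ck_on skew_hermitian k f)"

definition is_func_deriv :: "(complex^'n^'n \<Rightarrow> real) \<Rightarrow> complex^'n^'n \<Rightarrow> complex^'n^'n \<Rightarrow> bool" where
  "is_func_deriv f \<mu> \<xi> \<longleftrightarrow> \<xi> \<in> skew_hermitian \<and>
     (\<forall>\<nu>\<in>skew_hermitian.
        ((\<lambda>s. f (\<mu> + s *\<^sub>R \<nu>)) has_real_derivative u_inner \<nu> \<xi>) (at 0))"

definition func_deriv :: "(complex^'n^'n \<Rightarrow> real) \<Rightarrow> complex^'n^'n \<Rightarrow> complex^'n^'n" where
  "func_deriv f \<mu> = (THE \<xi>. is_func_deriv f \<mu> \<xi>)"

lemma u_inner_self: "u_inner A A = (\<Sum>i\<in>UNIV. \<Sum>j\<in>UNIV. (cmod (A $ j $ i))\<^sup>2) / 2"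
  by (simp add: u_inner_def trace_def matrix_matrix_mult_def conj_transpose_def transpose_def
      cmod_power2 flip: power2_eq_square)

lemma u_inner_self_eq_0: "u_inner A A = 0 \<Longrightarrow> A = 0"
  by (simp add: u_inner_self sum_nonneg_eq_0_iff sum_nonneg vec_eq_iff)

lemma u_inner_diff_right: "u_inner A (B - C) = u_inner A B - u_inner A C"
  by (simp add: u_inner_def trace_def matrix_matrix_mult_def right_diff_distrib sum_subtractf
      diff_divide_distrib)

lemma func_deriv_eqI:
  assumes "is_func_deriv f \<mu> \<xi>"
  shows "func_deriv f \<mu> = \<xi>"
  unfolding func_deriv_def
proof (rule the_equality[where P = "is_func_deriv f \<mu>", OF assms])
  fix \<eta> assume \<eta>: "is_func_deriv f \<mu> \<eta>"
  have mem: "\<eta> - \<xi> \<in> skew_hermitian"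
    using assms \<eta> by (auto simp: is_func_deriv_def skew_hermitian_def conj_transpose_def
        transpose_def vec_eq_iff)
  have "u_inner (\<eta> - \<xi>) \<eta> = u_inner (\<eta> - \<xi>) \<xi>"
    using assms \<eta> mem unfolding is_func_deriv_def by (blast intro: DERIV_unique)
  then have "u_inner (\<eta> - \<xi>) (\<eta> - \<xi>) = 0"
    by (simp add: u_inner_diff_right)
  then show "\<eta> = \<xi>"
    using u_inner_self_eq_0 by fastforce
qed

definition lie_poisson ::
    "('n::finite \<Rightarrow> int) \<Rightarrow> (complex^'n^'n \<Rightarrow> real) \<Rightarrow> (complex^'n^'n \<Rightarrow> real) \<Rightarrow> complex^'n^'n \<Rightarrow> real" where
  "lie_poisson \<Gamma> f k \<mu> = u_inner \<mu> (u_bracket \<Gamma> (func_deriv f \<mu>) (func_deriv k \<mu>))"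

definition is_casimir :: "('n::finite \<Rightarrow> int) \<Rightarrow> (complex^'n^'n \<Rightarrow> real) \<Rightarrow> bool" where
  "is_casimir \<Gamma> C \<longleftrightarrow> u_smooth C \<and>
     (\<forall>f. u_smooth f \<longrightarrow> (\<forall>\<mu>\<in>skew_hermitian. lie_poisson \<Gamma> C f \<mu> = 0))"

text \<open>The Hermitian matrix M with \<open>\<mu> = \<i>M\<close>.\<close>

definition herm :: "complex^'n^'n \<Rightarrow> complex^'n^'n" where
  "herm \<mu> = map_matrix (\<lambda>z. - \<i> * z) \<mu>"

definition herm_diag :: "complex^'n^'n \<Rightarrow> 'n \<Rightarrow> real" where
  "herm_diag \<mu> i = Re (herm \<mu> $ i $ i)"

definition ham_domain :: "(complex^('n::{finite,linorder})^('n::{finite,linorder})) set" where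
  "ham_domain = {\<mu> \<in> skew_hermitian. (\<forall>i. herm_diag \<mu> i < 1) \<and>
     (\<forall>i j. i < j \<longrightarrow> herm_diag \<mu> i + herm_diag \<mu> j - 2 * Re (herm \<mu> $ i $ j) > 0)}"

definition ham :: "('n::{finite,linorder} \<Rightarrow> int) \<Rightarrow> real \<Rightarrow> complex^('n::{finite,linorder})^('n::{finite,linorder}) \<Rightarrow> real" where
  "ham \<Gamma> c \<mu> = 1 / 2 * ((\<Sum>i\<in>UNIV. (of_int (\<Gamma> i))\<^sup>2 * ln (1 - herm_diag \<mu> i))
     - c * (\<Sum>(i, j)\<in>{(i, j). i < j}. of_int (\<Gamma> i) * of_int (\<Gamma> j) *
         ln (herm_diag \<mu> i + herm_diag \<mu> j - 2 * Re (herm \<mu> $ i $ j))))"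

text \<open>Solutions are taken on an arbitrary real interval T; at end points contained in T
  the derivative is one-sided.\<close>

definition lie_poisson_solution ::
    "('n::{finite,linorder} \<Rightarrow> int) \<Rightarrow> real \<Rightarrow> real set \<Rightarrow> (real \<Rightarrow> complex^('n::{finite,linorder})^('n::{finite,linorder})) \<Rightarrow> bool" where
  "lie_poisson_solution \<Gamma> c T \<mu> \<longleftrightarrow> is_interval T \<and>
     (\<forall>t\<in>T. \<mu> t \<in> ham_domain \<and>
        (\<mu> has_vector_derivative
           (matrix_inv (diag_mat \<Gamma>) ** func_deriv (ham \<Gamma> c) (\<mu> t) ** \<mu> t
            - \<mu> t ** func_deriv (ham \<Gamma> c) (\<mu> t) ** matrix_inv (diag_mat \<Gamma>))) (at t within T))"

text \<open>The trace below is real on skew-Hermitian matrices.\<close>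

definition casimir_fun :: "('n::finite \<Rightarrow> int) \<Rightarrow> complex^'n^'n \<Rightarrow> real" where
  "casimir_fun \<Gamma> \<mu> = Re (trace (map_matrix (\<lambda>z. - \<i> * z) (diag_mat \<Gamma> ** \<mu>)))"

end

theory Submission
  imports Defs
begin

text \<open>The Casimir function is linear and is represented, with respect to the inner product, by
  the constant matrix \<open>2\<i>D\<close>. Since \<open>2\<i>D ** D\<^sup>-\<^sup>1 ** \<eta> = 2\<i>\<eta> = \<eta> ** D\<^sup>-\<^sup>1 ** 2\<i>D\<close>, its bracket with
  every function vanishes. Along a solution the derivative of the Casimir function is the
  imaginary part of \<open>tr (F ** \<mu>) - tr (D ** \<mu> ** F ** D\<^sup>-\<^sup>1)\<close>, which is zero by cyclicity of the trace,
  whatever the matrix \<open>F\<close> in place of the functional derivative of the Hamiltonian.\<close>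

lemma Ck_on_const: "Ck_on V k (\<lambda>_. a)"
proof (induction k arbitrary: a)
  case (Suc k)
  have "((\<lambda>_. a) has_derivative (\<lambda>_. 0)) (at x within V)" for x
    by simp
  then show ?case
    using Suc by (auto intro!: exI[of _ "\<lambda>_ _. 0"])
qed simp

text \<open>The derivative at every point is \<open>f\<close> itself, so its value in a fixed
  direction does not depend on the base point. One differentiation thus reduces the claim to
  constants.\<close>

lemma Ck_on_bounded_linear:
  assumes "bounded_linear f"
  shows "Ck_on V k f"
proof (cases k)
  case 0
  then show ?thesis
    using linear_continuous_on[OF assms] by simp
next
  case (Suc k')
  then show ?thesis
    using bounded_linear_imp_has_derivative[OF assms] Ck_on_const
    by (auto intro!: exI[of _ "\<lambda>_. f"])
qed

lemma trace_diag_mat_mult: "trace (diag_mat \<Gamma> ** A) = (\<Sum>i\<in>UNIV. of_int (\<Gamma> i) * A $ i $ i)"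
  by (simp add: trace_def diag_mat_def matrix_matrix_mult_def if_distrib[of "\<lambda>x. x * _"] cong: if_cong)

lemma trace_map_matrix_mult:
  fixes a :: "'a::semiring_1"
  shows "trace (map_matrix (\<lambda>z. a * z) A) = a * trace A"
  by (simp add: trace_def map_matrix_def sum_distrib_left)

lemma map_matrix_mult_left:
  fixes a :: "'a::semiring_1"
  shows "map_matrix (\<lambda>z. a * z) A ** B = map_matrix (\<lambda>z. a * z) (A ** B)"
  by (simp add: vec_eq_iff map_matrix_def matrix_matrix_mult_def sum_distrib_left mult.assoc)

lemma map_matrix_mult_right:
  fixes a :: "'a::comm_semiring_1"
  shows "A ** map_matrix (\<lambda>z. a * z) B = map_matrix (\<lambda>z. a * z) (A ** B)"
  by (simp add: vec_eq_iff map_matrix_def matrix_matrix_mult_def sum_distrib_left mult.left_commute)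

lemma invertible_diag_mat:
  assumes "\<forall>i. \<Gamma> i \<noteq> 0"
  shows "invertible (diag_mat \<Gamma>)"
  unfolding invertible_def
proof (intro exI conjI)
  let ?B = "\<chi> i j. if i = j then 1 / of_int (\<Gamma> i) else (0::complex)"
  show "diag_mat \<Gamma> ** ?B = mat 1" "?B ** diag_mat \<Gamma> = mat 1"
    using assms
    by (auto simp: vec_eq_iff diag_mat_def matrix_matrix_mult_def mat_def if_distrib[of "\<lambda>x. x * _"]
        cong: if_cong)
qed

lemma diag_mat_matrix_inv:
  assumes "\<forall>i. \<Gamma> i \<noteq> 0"
  shows "diag_mat \<Gamma> ** matrix_inv (diag_mat \<Gamma>) = mat 1"
    and "matrix_inv (diag_mat \<Gamma>) ** diag_mat \<Gamma> = mat 1"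
  using someI_ex[OF invertible_diag_mat[OF assms, unfolded invertible_def]]
  by (simp_all add: matrix_inv_def)

lemma casimir_fun_eq_Im_trace: "casimir_fun \<Gamma> \<mu> = Im (trace (diag_mat \<Gamma> ** \<mu>))"
  \<comment> \<open>Since Re (-\<i>z) = Im z. The \<open>simplified\<close> attribute brings the
    factor -\<i> into the form that the simplifier produces in the goal.\<close>
  by (simp add: casimir_fun_def trace_map_matrix_mult[of "- \<i>", simplified])

lemma casimir_fun_eq_sum: "casimir_fun \<Gamma> \<mu> = (\<Sum>i\<in>UNIV. of_int (\<Gamma> i) * Im (\<mu> $ i $ i))"
  by (simp add: casimir_fun_eq_Im_trace trace_diag_mat_mult)

lemma bounded_linear_casimir_fun: "bounded_linear (casimir_fun \<Gamma>)"
proof -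
  have "casimir_fun \<Gamma> = (\<lambda>\<mu>. \<Sum>i\<in>UNIV. of_int (\<Gamma> i) * Im (\<mu> $ i $ i))"
    by (simp add: fun_eq_iff casimir_fun_eq_sum)
  then show ?thesis
    by (auto intro!: bounded_linear_intros bounded_linear_compose[OF bounded_linear_Im]
        bounded_linear_compose[OF bounded_linear_vec_nth])
qed

lemma skew_hermitian_diag_Re:
  assumes "\<mu> \<in> skew_hermitian"
  shows "Re (\<mu> $ i $ i) = 0"
proof -
  have "conj_transpose \<mu> $ i $ i = - \<mu> $ i $ i"
    using assms by (simp add: skew_hermitian_def)
  then show ?thesis
    by (simp add: conj_transpose_def transpose_def map_matrix_def complex_eq_iff)
qed

text \<open>By linearity the derivative in direction \<nu> is
  \<open>casimir_fun \<Gamma> \<nu>\<close>. In the representing matrix the factor 2 cancels the 1/2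
  in \<open>u_inner\<close>; the factor \<i> makes the real diagonal matrix skew-Hermitian and lets
  the inner product pick out Im of the diagonal entries of \<nu>.\<close>

lemma func_deriv_casimir_fun:
  "func_deriv (casimir_fun \<Gamma>) \<mu> = map_matrix (\<lambda>z. 2 * \<i> * z) (diag_mat \<Gamma>)" (is "_ = ?\<xi>")
proof (rule func_deriv_eqI)
  interpret C: bounded_linear "casimir_fun \<Gamma>"
    by (rule bounded_linear_casimir_fun)
  have "?\<xi> \<in> skew_hermitian"
    by (auto simp: skew_hermitian_def conj_transpose_def transpose_def map_matrix_def vec_eq_iff
        diag_mat_def)
  moreover have inner: "u_inner \<nu> ?\<xi> = casimir_fun \<Gamma> \<nu>" for \<nu>
    by (simp add: casimir_fun_eq_sum u_inner_def conj_transpose_def transpose_def map_matrix_def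
        trace_def matrix_matrix_mult_def diag_mat_def if_distrib[of "\<lambda>x. _ * x"] sum_divide_distrib mult.commute
        cong: if_cong)
  moreover have "((\<lambda>s. casimir_fun \<Gamma> (\<mu> + s *\<^sub>R \<nu>)) has_real_derivative casimir_fun \<Gamma> \<nu>) (at 0)" for \<nu>
    unfolding C.add C.scaleR by (auto intro!: derivative_eq_intros)
  ultimately show "is_func_deriv (casimir_fun \<Gamma>) \<mu> ?\<xi>"
    by (simp add: is_func_deriv_def)
qed

lemma is_casimir_casimir_fun:
  assumes "\<forall>i. \<Gamma> i \<noteq> 0"
  shows "is_casimir \<Gamma> (casimir_fun \<Gamma>)"
proof -
  have "u_bracket \<Gamma> (map_matrix (\<lambda>z. 2 * \<i> * z) (diag_mat \<Gamma>)) \<eta> = 0" for \<eta>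
    by (simp add: u_bracket_def map_matrix_mult_left map_matrix_mult_right diag_mat_matrix_inv[OF assms]
        flip: matrix_mul_assoc)
  \<comment> \<open>Reading 0 as 0 - 0 makes this an instance of additivity.\<close>
  moreover have "u_inner \<mu> 0 = 0" for \<mu> :: "complex^'a^'a"
    using u_inner_diff_right[of \<mu> 0 0] by simp
  ultimately show ?thesis
    by (simp add: is_casimir_def lie_poisson_def func_deriv_casimir_fun u_smooth_def
        Ck_on_bounded_linear bounded_linear_casimir_fun)
qed

text \<open>With \<open>A\<close> the current point and \<open>F\<close> the gradient of the
  Hamiltonian, the argument is the velocity of a solution; by linearity its image is the rate of
  change of the Casimir function.\<close>

lemma casimir_fun_commutator:
  assumes "\<forall>i. \<Gamma> i \<noteq> 0"
  shows "casimir_fun \<Gamma> (matrix_inv (diag_mat \<Gamma>) ** F ** A - A ** F ** matrix_inv (diag_mat \<Gamma>)) = 0"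
proof -
  let ?D = "diag_mat \<Gamma>"
  interpret C: bounded_linear "casimir_fun \<Gamma>"
    by (rule bounded_linear_casimir_fun)
  have "trace (?D ** (matrix_inv ?D ** F ** A)) = trace (F ** A)"
    by (simp add: matrix_mul_assoc diag_mat_matrix_inv[OF assms])
  \<comment> \<open>\<open>F\<close> and \<open>A\<close> are swapped cyclically and the identity is
    inserted on the right as an inverse times \<open>?D\<close>, so that a second cyclic shift can
    move \<open>?D\<close> to the front.\<close>
  also have "\<dots> = trace (A ** F ** matrix_inv ?D ** ?D)"
    by (simp add: trace_mul_sym[of F] diag_mat_matrix_inv[OF assms] flip: matrix_mul_assoc)
  also have "\<dots> = trace (?D ** (A ** F ** matrix_inv ?D))"
    by (rule trace_mul_sym)
  finally show ?thesis
    by (simp only: C.diff) (simp add: casimir_fun_eq_Im_trace)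
qed

lemma casimir_fun_invariant:
  assumes "\<forall>i. \<Gamma> i \<noteq> 0" and sol: "lie_poisson_solution \<Gamma> c T \<mu>" and "s \<in> T" "t \<in> T"
  shows "casimir_fun \<Gamma> (\<mu> s) = casimir_fun \<Gamma> (\<mu> t)"
proof -
  have "((\<lambda>t. casimir_fun \<Gamma> (\<mu> t)) has_vector_derivative 0) (at t within T)" if "t \<in> T" for t
    using sol that bounded_linear.has_vector_derivative[OF bounded_linear_casimir_fun]
      casimir_fun_commutator[OF assms(1)]
    unfolding lie_poisson_solution_def by metis
  \<comment> \<open>Convexity of the interval turns a vanishing derivative within \<open>T\<close>,
    one-sided at end points, into constancy on \<open>T\<close>.\<close>
  moreover have "convex T"
    using sol by (simp add: lie_poisson_solution_def is_interval_convex)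
  ultimately obtain a where "\<And>t. t \<in> T \<Longrightarrow> casimir_fun \<Gamma> (\<mu> t) = a"
    using has_vector_derivative_zero_constant by metis
  then show ?thesis
    using assms by simp
qed

theorem proposition2p1:
  fixes \<Gamma> :: "'n::{finite,linorder} \<Rightarrow> int" and c :: real
  assumes "\<forall>i. \<Gamma> i \<noteq> 0" and "c > 0"
  shows "(\<forall>\<mu>\<in>skew_hermitian.
            complex_of_real (casimir_fun \<Gamma> \<mu>) = trace (map_matrix (\<lambda>z. - \<i> * z) (diag_mat \<Gamma> ** \<mu>)) \<and>
            casimir_fun \<Gamma> \<mu> = (\<Sum>i\<in>UNIV. of_int (\<Gamma> i) * herm_diag \<mu> i))
       \<and> is_casimir \<Gamma> (casimir_fun \<Gamma>)
       \<and> (\<forall>T \<mu>. lie_poisson_solution \<Gamma> c T \<mu> \<longrightarrow>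
            (\<forall>s\<in>T. \<forall>t\<in>T. casimir_fun \<Gamma> (\<mu> s) = casimir_fun \<Gamma> (\<mu> t)))"
proof (intro conjI ballI allI impI)
  fix \<mu> :: "((complex, 'n) vec, 'n) vec" assume "\<mu> \<in> skew_hermitian"
  \<comment> \<open>Im (-\<i>z) = -Re z, and the diagonal of \<mu> is purely imaginary. Hence the
    trace is real and the \<open>Re\<close> in \<open>casimir_fun\<close> loses nothing.\<close>
  then have "Im (trace (map_matrix (\<lambda>z. - \<i> * z) (diag_mat \<Gamma> ** \<mu>))) = 0"
    unfolding trace_map_matrix_mult trace_diag_mat_mult by (simp add: skew_hermitian_diag_Re)
  then show "complex_of_real (casimir_fun \<Gamma> \<mu>) = trace (map_matrix (\<lambda>z. - \<i> * z) (diag_mat \<Gamma> ** \<mu>))"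
    by (simp add: casimir_fun_def complex_eq_iff)
  show "casimir_fun \<Gamma> \<mu> = (\<Sum>i\<in>UNIV. of_int (\<Gamma> i) * herm_diag \<mu> i)"
    by (simp add: casimir_fun_eq_sum herm_diag_def herm_def map_matrix_def)
next
  show "is_casimir \<Gamma> (casimir_fun \<Gamma>)"
    using assms(1) by (rule is_casimir_casimir_fun)
next
  fix T \<mu> s t
  assume "lie_poisson_solution \<Gamma> c T \<mu>" "s \<in> T" "t \<in> T"
  then show "casimir_fun \<Gamma> (\<mu> s) = casimir_fun \<Gamma> (\<mu> t)"
    using casimir_fun_invariant assms(1) by blast
qed

end
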